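(* Let $n\geqslant 2$ be an integer, let $(X,d)$ be a metric space with $|X|\geqslant n$, and let $T\colon X\to X$ be a mapping contracting total pairwise distance on $n$ points. Then $T$ is continuous.
   Context: $|X|$ denotes the cardinality of $X$. For points $x_1,\ldots,x_n$ of a metric space $(X,d)$, $n\geqslant 2$, the total pairwise distance is $S(x_1,\ldots,x_n)=\sum_{1\leqslant i<j\leqslant n} d(x_i,x_j)$. Let $n\geqslant 2$ and let $(X,d)$ be a metric space with $|X|\geqslant n$. A map $T\colon X\to X$ is a mapping contracting total pairwise distance on $n$ points if there exists $\alpha\in[0,1)$ such that $S(Tx_1,\ldots,Tx_n)\leqslant \alpha\, S(x_1,\ldots,x_n)$ for all $n$ pairwise distinct points $x_1,\ldots,x_n\in X$. *)

theory Defs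
  imports "HOL-Analysis.Analysis"
begin

definition total_pairwise_distance :: "('a \<Rightarrow> 'a \<Rightarrow> real) \<Rightarrow> nat \<Rightarrow> (nat \<Rightarrow> 'a) \<Rightarrow> real" where
  "total_pairwise_distance d n x = (\<Sum>i = 1..n. \<Sum>j = i + 1..n. d (x i) (x j))"

text \<open>A tuple of \<open>n\<close> points is encoded by a function on \<open>nat\<close>, of which only the values on
  \<open>{1..n}\<close> matter; injectivity on \<open>{1..n}\<close> says that the points are pairwise distinct.\<close>

definition contracting_total_pairwise_distance ::
  "'a set \<Rightarrow> ('a \<Rightarrow> 'a \<Rightarrow> real) \<Rightarrow> nat \<Rightarrow> ('a \<Rightarrow> 'a) \<Rightarrow> bool" where
  "contracting_total_pairwise_distance X d n T \<longleftrightarrow>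
     T \<in> X \<rightarrow> X \<and>
     (\<exists>\<alpha>\<in>{0..<1}. \<forall>x. x \<in> {1..n} \<rightarrow> X \<and> inj_on x {1..n} \<longrightarrow>
        total_pairwise_distance d n (\<lambda>i. T (x i)) \<le> \<alpha> * total_pairwise_distance d n x)"

end

theory Submission
  imports Defs
begin

text \<open>Continuity at an isolated point is automatic. If \<open>p\<close> is not isolated, every ball around \<open>p\<close>
  is infinite, so any \<open>q\<close> in the ball of radius \<open>\<delta>\<close> can be completed, together with \<open>p\<close>, to \<open>n\<close>
  distinct points of that ball. A single distance \<open>d (T p) (T q)\<close> is at most the total pairwise
  distance of the images, which is at most the total pairwise distance of the \<open>n\<close> points, and the
  latter is of order \<open>n\<^sup>2 \<delta>\<close>.\<close>

text \<open>Removing \<open>p\<close> and \<open>q\<close> leaves an infinite set, so it contains an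
  injective sequence. Overwriting its values at 1 and 2 by \<open>p\<close> and \<open>q\<close>
  creates no repetition.\<close>

lemma inj_on_Icc_extending_pair:
  assumes "infinite B" "p \<in> B" "q \<in> B" "p \<noteq> q"
  obtains x :: "nat \<Rightarrow> 'a" where "x 1 = p" "x 2 = q" "x \<in> {1..n} \<rightarrow> B" "inj_on x {1..n}"
proof -
  have "infinite (B - {p, q})"
    using assms by simp
  then obtain g :: "nat \<Rightarrow> 'a" where g: "inj g" "range g \<subseteq> B - {p, q}"
    using infinite_countable_subset by blast
  define x where "x i = (if i = 1 then p else if i = 2 then q else g i)" for i :: nat
  have "g i \<in> B" "g i \<noteq> p" "g i \<noteq> q" for i
    using g(2) by auto
  then have "x \<in> {1..n} \<rightarrow> B" and "inj x"
    using assms injD[OF g(1)] by (auto simp: x_def inj_def split: if_splits)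
  then show thesis
    using that[of x] by (simp add: x_def inj_on_subset)
qed

text \<open>All terms are nonnegative, so one term is bounded by its inner sum, and that inner sum
  by the double sum.\<close>

lemma dist_le_total_pairwise_distance:
  assumes "\<And>u v. 0 \<le> d u v" "1 \<le> i" "i < j" "j \<le> n"
  shows "d (x i) (x j) \<le> total_pairwise_distance d n x"
proof -
  have "d (x i) (x j) \<le> (\<Sum>j = i + 1..n. d (x i) (x j))"
    using assms by (intro member_le_sum) auto
  also have "\<dots> \<le> (\<Sum>i = 1..n. \<Sum>j = i + 1..n. d (x i) (x j))"
    using assms by (intro member_le_sum[of i _ "\<lambda>i. \<Sum>j = i + 1..n. d (x i) (x j)"] sum_nonneg) auto
  finally show ?thesis
    by (simp add: total_pairwise_distance_def)
qed

lemma total_pairwise_distance_le: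
  assumes "\<And>i j. i \<in> {1..n} \<Longrightarrow> j \<in> {1..n} \<Longrightarrow> d (x i) (x j) \<le> c" "0 \<le> c"
  shows "total_pairwise_distance d n x \<le> real n * (real n * c)"
proof -
  have "(\<Sum>j = i + 1..n. d (x i) (x j)) \<le> real n * c" if "i \<in> {1..n}" for i
  proof -
    have "(\<Sum>j = i + 1..n. d (x i) (x j)) \<le> real (card {i + 1..n}) * c"
      using assms(1) that by (intro sum_bounded_above) auto
    \<comment> \<open>The inner sum has fewer than \<open>n\<close> terms; 0 \<le> \<open>c\<close>
      allows rounding their number up to \<open>n\<close>.\<close>
    also have "\<dots> \<le> real n * c"
      using assms(2) by (intro mult_right_mono) auto
    finally show ?thesis .
  qed
  then show ?thesis
    using sum_bounded_above[of "{1..n}" "\<lambda>i. \<Sum>j = i + 1..n. d (x i) (x j)" "real n * c"]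
    by (simp add: total_pairwise_distance_def)
qed

lemma (in Metric_space) finite_mball_isolated:
  assumes "finite (mball p \<delta>)" "0 < \<delta>"
  obtains r where "0 < r" "\<And>q. p \<in> M \<Longrightarrow> q \<in> M \<Longrightarrow> d p q < r \<Longrightarrow> q = p"
proof
  \<comment> \<open>Including \<delta> keeps the set nonempty when the ball has no point besides
    \<open>p\<close>, and forces every point closer to \<open>p\<close> than the minimum into the
    ball.\<close>
  let ?R = "insert \<delta> (d p ` (mball p \<delta> - {p}))"
  have fin: "finite ?R"
    using assms(1) by simp
  show "0 < Min ?R"
    using fin assms(2) by (auto simp: Min_gr_iff in_mball)
  show "q = p" if "p \<in> M" "q \<in> M" "d p q < Min ?R" for q
  proof (rule ccontr)
    assume "q \<noteq> p"
    with that fin have "d p q \<in> ?R"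
      by (auto simp: in_mball)
    with fin that show False
      by (meson Min_le not_less)
  qed
qed

theorem proposition2p1:
  fixes X :: "'a set" and d :: "'a \<Rightarrow> 'a \<Rightarrow> real" and n :: nat and T :: "'a \<Rightarrow> 'a"
  assumes "n \<ge> 2"
    and "Metric_space X d"
    and "infinite X \<or> card X \<ge> n"
    and "contracting_total_pairwise_distance X d n T"
  shows "continuous_map (Metric_space.mtopology X d) (Metric_space.mtopology X d) T"
proof -
  interpret Metric_space X d
    by fact
  obtain \<alpha> where T: "T \<in> X \<rightarrow> X" and \<alpha>: "0 \<le> \<alpha>" "\<alpha> < 1"
    and contr: "\<And>x. x \<in> {1..n} \<rightarrow> X \<Longrightarrow> inj_on x {1..n} \<Longrightarrow>
      total_pairwise_distance d n (\<lambda>i. T (x i)) \<le> \<alpha> * total_pairwise_distance d n x"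
    using assms(4) by (auto simp: contracting_total_pairwise_distance_def)
  have "\<exists>\<delta>>0. \<forall>q. q \<in> X \<and> d p q < \<delta> \<longrightarrow> d (T p) (T q) < \<epsilon>" if "p \<in> X" "0 < \<epsilon>" for p \<epsilon>
  proof -
    \<comment> \<open>Chosen so that the final bound \<open>n * (n * (2 * \<delta>))\<close> equals
      \<epsilon>/2.\<close>
    define \<delta> where "\<delta> = \<epsilon> / (4 * real n * real n)"
    have \<delta>: "0 < \<delta>"
      using assms(1) that by (simp add: \<delta>_def)
    show ?thesis
    proof (cases "finite (mball p \<delta>)")
      \<comment> \<open>Here \<open>p\<close> is isolated: within a small enough radius only
        \<open>q = p\<close> remains, where the image distance is 0.\<close>
      case True
      with \<delta> that T show ?thesis
        by (metis finite_mball_isolated mdist_zero Pi_mem)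
    next
      case False
      have "d (T p) (T q) < \<epsilon>" if q: "q \<in> X" "d p q < \<delta>" "q \<noteq> p" for q
      proof -
        obtain x where x: "x 1 = p" "x 2 = q" "x \<in> {1..n} \<rightarrow> mball p \<delta>" "inj_on x {1..n}"
          using inj_on_Icc_extending_pair[OF False, of p q n] q \<delta> \<open>p \<in> X\<close> by auto
        \<comment> \<open>Triangle inequality through the centre \<open>p\<close>.\<close>
        have diam: "d (x i) (x j) \<le> 2 * \<delta>" if "i \<in> {1..n}" "j \<in> {1..n}" for i j
        proof -
          have "x i \<in> mball p \<delta>" "x j \<in> mball p \<delta>"
            using x(3) that by auto
          then show ?thesis
            using triangle[of "x i" p "x j"] commute[of "x i" p] by auto
        qed
        have "d (T p) (T q) \<le> total_pairwise_distance d n (\<lambda>i. T (x i))"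
          using dist_le_total_pairwise_distance[of d 1 2 n "\<lambda>i. T (x i)"] x(1,2) assms(1) by simp
        also have "\<dots> \<le> \<alpha> * total_pairwise_distance d n x"
          using x(3,4) by (intro contr) auto
        also have "\<dots> \<le> total_pairwise_distance d n x"
          using \<alpha> by (intro mult_left_le_one_le)
            (auto simp: total_pairwise_distance_def intro!: sum_nonneg)
        also have "\<dots> \<le> real n * (real n * (2 * \<delta>))"
          using diam \<delta> by (intro total_pairwise_distance_le) auto
        also have "\<dots> < \<epsilon>"
          using assms(1) \<open>0 < \<epsilon>\<close> by (simp add: \<delta>_def)
        finally show ?thesis .
      qed
      \<comment> \<open>What remains is \<open>q = p\<close>, set apart because the tuple needs
        distinct points; there the image distance is 0.\<close>
      with \<delta> that T show ?thesis
        by (metis mdist_zero Pi_mem)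
    qed
  qed
  with T show ?thesis
    by (simp add: metric_continuous_map[OF assms(2)] image_subset_iff_funcset)
qed

end
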